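(* Let $\mu$ be a Radon measure on $\mathbb{R}^{n+m}$, $1<p<\infty$, $\gamma>0$. Let $\alpha,\beta,\alpha',\beta'\in\mathbb{R}$ satisfy $\alpha+\beta=1$, $\beta\le0$, $\alpha'+\beta'=1$, $0\le\alpha'<1$. For $f\in L^1_{\rm loc}(\mathbb{R}^{n+m},\mu)$ and a dyadic rectangle $R\in\mathcal{D}_n\times\mathcal{D}_m$ set $$a(f)_R=\ell_{\alpha,\beta}(R)^{\gamma/p}\,\frac1{\mu(R)}\int_Rf\,d\mu\ \text{ if }\mu(R)>0,\qquad a(f)_R=0\ \text{ otherwise}.$$ Then $$\Big(\sup_{\lambda>0}\lambda^p\sum_{R\in\mathcal{D}_n\times\mathcal{D}_m,\ |a(f)_R|>\lambda}\ell_{\alpha',\beta'}(R)^{-\gamma}\mu(R)\Big)^{1/p}\le C\,\|f\|_{L^p(\mathbb{R}^{n+m},\mu)}$$ with a constant $C$ independent of $f$.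
   Context: $\mathcal{D}_n$ is the collection of half-open dyadic cubes $[j_12^k,(j_1+1)2^k)\times\cdots\times[j_n2^k,(j_n+1)2^k)$ in $\mathbb{R}^n$, $k\in\mathbb{Z}$, $j\in\mathbb{Z}^n$, and similarly $\mathcal{D}_m$ in $\mathbb{R}^m$. A dyadic rectangle is $R=Q_1\times Q_2$ with $Q_1\in\mathcal{D}_n$, $Q_2\in\mathcal{D}_m$ (the collection of these is denoted $\mathcal{D}_n\times\mathcal{D}_m$); $\ell_1(R)=\ell(Q_1)$ and $\ell_2(R)=\ell(Q_2)$ are the sidelengths, $\ell_{\min}(R)=\min(\ell_1(R),\ell_2(R))$, $\ell_{\max}(R)=\max(\ell_1(R),\ell_2(R))$, and for real $\alpha,\beta$ with $\alpha+\beta=1$, $$\ell_{\alpha,\beta}(R)=\ell_{\min}(R)^{\alpha}\,\ell_{\max}(R)^{\beta}.$$ *)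

theory Defs
  imports "HOL-Analysis.Analysis"
begin

text \<open>\<open>\<real>\<^sup>n\<^sup>+\<^sup>m\<close> is represented by the product type \<open>(real^'n) \<times> (real^'m)\<close>.\<close>

definition dyadic_cube :: "int \<Rightarrow> ('n::finite \<Rightarrow> int) \<Rightarrow> (real^'n) set" where
  "dyadic_cube k j =
     {x. \<forall>i. of_int (j i) * 2 powi k \<le> x $ i \<and> x $ i < (of_int (j i) + 1) * 2 powi k}"

definition dyadic_cubes :: "(real^'n::finite) set set" where
  "dyadic_cubes = {dyadic_cube k j |k j. True}"

text \<open>The side length is read off from the cube as a set; this is justified by
  \<open>sidelength_dyadic_cube\<close> below.\<close>

definition sidelength :: "(real^'n::finite) set \<Rightarrow> real" where
  "sidelength Q = (THE l. \<exists>k j. Q = dyadic_cube k j \<and> l = 2 powi k)"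

lemma dyadic_cube_side_le:
  fixes j j' :: "'n::finite \<Rightarrow> int"
  assumes eq: "dyadic_cube k j = dyadic_cube k' j'"
  shows "(2::real) powi k \<le> 2 powi k'"
proof -
  define x :: "real^'n" where "x = (\<chi> i. of_int (j i) * 2 powi k)"
  define y :: "real^'n" where "y = (\<chi> i. of_int (j' i) * 2 powi k')"
  have pos: "(0::real) < 2 powi l" for l :: int by simp
  have "x \<in> dyadic_cube k j" "y \<in> dyadic_cube k' j'"
    using pos by (auto simp: x_def y_def dyadic_cube_def algebra_simps)
  then have "x \<in> dyadic_cube k' j'" "y \<in> dyadic_cube k j"
    using eq by auto
  then have xy: "x = y"
    unfolding vec_eq_iff by (intro allI antisym) (simp_all add: x_def y_def dyadic_cube_def)
  define z :: "real^'n" where "z = (\<chi> i. y $ i + 2 powi k')"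
  have "z \<notin> dyadic_cube k' j'"
    by (auto simp: z_def y_def dyadic_cube_def algebra_simps)
  then have "z \<notin> dyadic_cube k j"
    using eq by auto
  then obtain i where
    "\<not> (of_int (j i) * 2 powi k \<le> z $ i \<and> z $ i < (of_int (j i) + 1) * 2 powi k)"
    by (auto simp: dyadic_cube_def)
  moreover have "z $ i = of_int (j i) * 2 powi k + 2 powi k'"
    using xy by (simp add: z_def x_def vec_eq_iff)
  ultimately show ?thesis
    using pos[of k'] by (simp add: algebra_simps)
qed

lemma sidelength_dyadic_cube: "sidelength (dyadic_cube k j) = 2 powi k"
  unfolding sidelength_def
proof (rule the_equality)
  show "\<exists>k' j'. dyadic_cube k j = dyadic_cube k' j' \<and> (2::real) powi k = 2 powi k'"
    by blast
next
  fix l :: real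
  assume "\<exists>k' j'. dyadic_cube k j = dyadic_cube k' j' \<and> l = 2 powi k'"
  then obtain k' j' where eq: "dyadic_cube k j = dyadic_cube k' j'" and l: "l = 2 powi k'"
    by blast
  show "l = 2 powi k"
    unfolding l
    by (rule antisym[OF dyadic_cube_side_le[OF eq[symmetric]] dyadic_cube_side_le[OF eq]])
qed

text \<open>A dyadic rectangle is given by the pair of its two factors.\<close>

type_synonym ('n, 'm) rectangle = "(real^'n) set \<times> (real^'m) set"

definition dyadic_rectangles :: "('n::finite, 'm::finite) rectangle set" where
  "dyadic_rectangles = dyadic_cubes \<times> dyadic_cubes"

definition rect_set :: "('n::finite, 'm::finite) rectangle \<Rightarrow> ((real^'n) \<times> (real^'m)) set" where
  "rect_set R = fst R \<times> snd R"

definition ell_min :: "('n::finite, 'm::finite) rectangle \<Rightarrow> real" where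
  "ell_min R = min (sidelength (fst R)) (sidelength (snd R))"

definition ell_max :: "('n::finite, 'm::finite) rectangle \<Rightarrow> real" where
  "ell_max R = max (sidelength (fst R)) (sidelength (snd R))"

definition ell :: "real \<Rightarrow> real \<Rightarrow> ('n::finite, 'm::finite) rectangle \<Rightarrow> real" where
  "ell \<alpha> \<beta> R = ell_min R powr \<alpha> * ell_max R powr \<beta>"

definition radon_measure :: "'a::t2_space measure \<Rightarrow> bool" where
  "radon_measure M \<longleftrightarrow>
     sets M = sets borel \<and>
     (\<forall>K. compact K \<longrightarrow> emeasure M K < \<infinity>) \<and>
     (\<forall>A\<in>sets M. emeasure M A = (INF U\<in>{U. open U \<and> A \<subseteq> U}. emeasure M U)) \<and>
     (\<forall>U. open U \<longrightarrow> emeasure M U = (SUP K\<in>{K. compact K \<and> K \<subseteq> U}. emeasure M K))"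

definition L1_loc :: "'a::t2_space measure \<Rightarrow> ('a \<Rightarrow> complex) set" where
  "L1_loc M = {f \<in> borel_measurable M. \<forall>K. compact K \<longrightarrow> set_integrable M K f}"

text \<open>Powers of extended nonnegative reals, for exponents \<open>r > 0\<close>.\<close>

definition ennreal_powr :: "ennreal \<Rightarrow> real \<Rightarrow> ennreal" where
  "ennreal_powr x r = (if x = \<infinity> then \<infinity> else ennreal (enn2real x powr r))"

text \<open>The \<open>L\<^sup>p\<close> norm, with value \<open>\<infinity>\<close> for functions not in \<open>L\<^sup>p\<close>.\<close>

definition Lp_norm :: "'a measure \<Rightarrow> real \<Rightarrow> ('a \<Rightarrow> complex) \<Rightarrow> ennreal" where
  "Lp_norm M p f = ennreal_powr (\<integral>\<^sup>+x. ennreal (norm (f x) powr p) \<partial>M) (1 / p)"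

definition coeff_a ::
    "((real^'n::finite) \<times> (real^'m::finite)) measure \<Rightarrow> real \<Rightarrow> real \<Rightarrow> real \<Rightarrow> real \<Rightarrow>
     ((real^'n) \<times> (real^'m) \<Rightarrow> complex) \<Rightarrow> ('n, 'm) rectangle \<Rightarrow> complex" where
  "coeff_a M p \<gamma> \<alpha> \<beta> f R =
     (if emeasure M (rect_set R) > 0
      then of_real (ell \<alpha> \<beta> R powr (\<gamma> / p) * (1 / measure M (rect_set R))) *
           (LINT x:rect_set R|M. f x)
      else 0)"

end

theory Submission
  imports Defs
begin

text \<open>Let \<open>R\<close> have smaller side \<open>2\<^sup>k\<close> and larger side \<open>2\<^sup>k\<^sup>+\<^sup>g\<close>. Since \<open>\<beta> \<le> 0\<close>, the condition
  \<open>\<bar>a(f)\<^sub>R\<bar> > t\<close> forces the average of \<open>\<bar>f\<bar>\<close> over \<open>R\<close> to exceed \<open>s = t 2 powr (- k \<gamma> / p)\<close>, so truncating \<open>f\<close> at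
  height \<open>s / 2\<close> gives \<open>\<mu>(R) \<le> (2 / s) \<integral>\<close> of \<open>\<bar>f\<bar>\<close> over \<open>R \<inter> {\<bar>f\<bar> > s / 2}\<close>. No maximal function is
  needed: after exchanging sum and integral, a point lies in exactly one rectangle for each pair of
  side lengths, the weight \<open>\<ell>(R) powr (-\<gamma>)\<close> decays geometrically in \<open>g\<close> because \<open>\<alpha>' < 1\<close>, and the
  constraint \<open>s < 2 \<bar>f\<bar>\<close> makes the sum over \<open>k\<close> a geometric series of size \<open>(\<bar>f\<bar> / t) powr (p - 1)\<close>
  because \<open>p > 1\<close>.\<close>

section \<open>Geometric sums over finite sets of integers\<close>

lemma sum_geometric_int_le:
  fixes q :: real and A :: "int set"
  assumes "finite A" and ge: "\<And>k. k \<in> A \<Longrightarrow> k0 \<le> k" and q: "0 < q" "q < 1"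
  shows "(\<Sum>k\<in>A. q ^ nat (k - k0)) \<le> 1 / (1 - q)"
proof -
  have inj: "inj_on (\<lambda>k. nat (k - k0)) A"
    using ge by (auto simp: inj_on_def) (metis diff_add_cancel eq_nat_nat_iff le_iff_diff_le_0 diff_ge_0_iff_ge)
  have "(\<Sum>k\<in>A. q ^ nat (k - k0)) = (\<Sum>n\<in>(\<lambda>k. nat (k - k0)) ` A. q ^ n)"
    using inj by (simp add: sum.reindex)
  also have "\<dots> \<le> (\<Sum>n. q ^ n)"
    using assms by (intro sum_le_suminf) (auto intro: summable_geometric)
  finally show ?thesis
    using q by (simp add: suminf_geometric)
qed

text \<open>The constraint bounds the indices from below. The sum is at most a full geometric series
  starting at the least index \<open>k0\<close>, and its first term is
  \<open>(2 powr (- c * k0)) powr (d / c)\<close>, which the constraint at \<open>k0\<close>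
  controls.\<close>

lemma sum_powr_int_tail_le:
  fixes c d y :: real and A :: "int set"
  assumes "finite A" "0 < c" "0 < d" "0 \<le> y"
    and less: "\<And>k. k \<in> A \<Longrightarrow> 2 powr (- c * k) < y"
  shows "(\<Sum>k\<in>A. 2 powr (- d * k)) \<le> y powr (d / c) / (1 - 2 powr (- d))"
proof (cases "A = {}")
  case True
  have "2 powr (- d) < 1"
    using assms by (simp add: powr_less_one)
  then show ?thesis using True by simp
next
  case False
  define k0 where "k0 = Min A"
  have k0: "k0 \<in> A" "\<And>k. k \<in> A \<Longrightarrow> k0 \<le> k"
    using assms(1) False by (auto simp: k0_def)
  have q: "0 < 2 powr (- d)" "2 powr (- d) < 1"
    using assms by (auto simp: powr_less_one)
  have "2 powr (- d * k) = 2 powr (- d * k0) * (2 powr (- d)) ^ nat (k - k0)" if "k \<in> A" for k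
  proof -
    have "(2 powr (- d)) ^ nat (k - k0) = 2 powr (- d * real (nat (k - k0)))"
      by (simp add: powr_powr flip: powr_realpow)
    also have "\<dots> = 2 powr (- d * (real_of_int k - real_of_int k0))"
      using k0(2)[OF that] by simp
    finally show ?thesis by (simp add: algebra_simps flip: powr_add)
  qed
  then have "(\<Sum>k\<in>A. 2 powr (- d * k)) = 2 powr (- d * k0) * (\<Sum>k\<in>A. (2 powr (- d)) ^ nat (k - k0))"
    by (simp add: sum_distrib_left)
  also have "\<dots> \<le> 2 powr (- d * k0) * (1 / (1 - 2 powr (- d)))"
    using sum_geometric_int_le[OF assms(1) k0(2) q] by (intro mult_left_mono) auto
  also have "2 powr (- d * k0) = (2 powr (- c * k0)) powr (d / c)"
    using assms by (simp add: powr_powr mult.commute)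
  also have "\<dots> * (1 / (1 - 2 powr (- d))) \<le> y powr (d / c) * (1 / (1 - 2 powr (- d)))"
    using less[OF k0(1)] assms q by (intro mult_right_mono powr_mono2) auto
  finally show ?thesis by simp
qed

text \<open>Nonnegative indices and reflected negative indices contribute at most one geometric
  series each, whence the factor 2.\<close>

lemma sum_powr_abs_int_le:
  fixes e :: real and A :: "int set"
  assumes "finite A" "0 < e"
  shows "(\<Sum>k\<in>A. 2 powr (- e * \<bar>real_of_int k\<bar>)) \<le> 2 / (1 - 2 powr (- e))"
proof -
  have half: "(\<Sum>k\<in>B. 2 powr (- e * k)) \<le> 1 / (1 - 2 powr (- e))"
    if "finite B" "B \<subseteq> {0..}" for B :: "int set"
  proof -
    have "(\<Sum>k\<in>B. 2 powr (- e * k)) = (\<Sum>k\<in>B. (2 powr (- e)) ^ nat (k - 0))"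
    proof (rule sum.cong)
      fix k assume "k \<in> B"
      then have "0 \<le> k" using that by auto
      then show "2 powr (- e * k) = (2 powr (- e)) ^ nat (k - 0)"
        by (simp add: powr_powr flip: powr_realpow)
    qed simp
    also have "\<dots> \<le> 1 / (1 - 2 powr (- e))"
      using that assms by (intro sum_geometric_int_le) (auto simp: powr_less_one)
    finally show ?thesis .
  qed
  have "(\<Sum>k\<in>A. 2 powr (- e * \<bar>real_of_int k\<bar>)) =
      (\<Sum>k\<in>A \<inter> {0..}. 2 powr (- e * \<bar>real_of_int k\<bar>)) + (\<Sum>k\<in>A - {0..}. 2 powr (- e * \<bar>real_of_int k\<bar>))"
    using assms by (rule_tac sum.Int_Diff) auto
  also have "(\<Sum>k\<in>A \<inter> {0..}. 2 powr (- e * \<bar>real_of_int k\<bar>)) = (\<Sum>k\<in>A \<inter> {0..}. 2 powr (- e * k))"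
    by (intro sum.cong) auto
  also have "(\<Sum>k\<in>A - {0..}. 2 powr (- e * \<bar>real_of_int k\<bar>)) = (\<Sum>k\<in>uminus ` (A - {0..}). 2 powr (- e * k))"
    by (subst sum.reindex) (auto intro!: sum.cong)
  also have "(\<Sum>k\<in>A \<inter> {0..}. 2 powr (- e * k)) + (\<Sum>k\<in>uminus ` (A - {0..}). 2 powr (- e * k))
      \<le> 1 / (1 - 2 powr (- e)) + 1 / (1 - 2 powr (- e))"
    using assms by (intro add_mono half) auto
  finally show ?thesis by simp
qed

text \<open>The injective substitution \<open>(k, l)\<close> to \<open>(min k l, k - l)\<close>
  separates the variables: the constraint sees only the first new coordinate, and the second one is
  summed freely.\<close>

lemma sum_powr_min_diff_le:
  fixes c d e y :: real and G :: "(int \<times> int) set"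
  assumes "finite G" "0 < c" "0 < d" "0 < e" "0 \<le> y"
    and less: "\<And>k l. (k, l) \<in> G \<Longrightarrow> 2 powr (- c * real_of_int (min k l)) < y"
  shows "(\<Sum>(k, l)\<in>G. 2 powr (- d * real_of_int (min k l)) * 2 powr (- e * \<bar>real_of_int (k - l)\<bar>))
    \<le> y powr (d / c) * (2 / ((1 - 2 powr (- d)) * (1 - 2 powr (- e))))"
proof -
  define h where "h = (\<lambda>(k::int, l). (min k l, k - l))"
  define A where "A = fst ` h ` G"
  define B where "B = snd ` h ` G"
  have fin: "finite A" "finite B" using assms by (auto simp: A_def B_def)
  have inj: "inj_on h G"
    by (auto simp: inj_on_def h_def min_def split: if_splits)
  have sub: "h ` G \<subseteq> A \<times> B"
    unfolding A_def B_def by (rule subset_fst_snd)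
  have A: "2 powr (- c * k) < y" if "k \<in> A" for k
    using that less by (auto simp: A_def h_def)
  have "(\<Sum>(k, l)\<in>G. 2 powr (- d * real_of_int (min k l)) * 2 powr (- e * \<bar>real_of_int (k - l)\<bar>))
      = (\<Sum>(m, s)\<in>h ` G. 2 powr (- d * m) * 2 powr (- e * \<bar>real_of_int s\<bar>))"
    using inj by (subst sum.reindex) (auto simp: h_def intro!: sum.cong)
  \<comment> \<open>All terms are nonnegative, so the image may be enlarged to a full product, over
    which the sum factors.\<close>
  also have "\<dots> \<le> (\<Sum>(m, s)\<in>A \<times> B. 2 powr (- d * m) * 2 powr (- e * \<bar>real_of_int s\<bar>))"
    using fin sub by (intro sum_mono2) auto
  also have "\<dots> = (\<Sum>m\<in>A. 2 powr (- d * m)) * (\<Sum>s\<in>B. 2 powr (- e * \<bar>real_of_int s\<bar>))"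
    by (simp add: sum_product sum.cartesian_product)
  also have "\<dots> \<le> y powr (d / c) / (1 - 2 powr (- d)) * (2 / (1 - 2 powr (- e)))"
    using assms fin A
    by (intro mult_mono sum_powr_int_tail_le sum_powr_abs_int_le sum_nonneg)
      (auto simp: powr_less_one less_imp_le)
  finally show ?thesis by (simp add: mult.commute)
qed

section \<open>Levels of dyadic cubes and rectangles\<close>

text \<open>A cube is given only as a set, so its exponent is recovered from the side length; the
  floor merely turns the real logarithm into an integer.\<close>

definition dyadic_level :: "(real^'n::finite) set \<Rightarrow> int" where
  "dyadic_level Q = \<lfloor>log 2 (sidelength Q)\<rfloor>"

lemma dyadic_level_dyadic_cube [simp]: "dyadic_level (dyadic_cube k j) = k"
  by (simp add: dyadic_level_def sidelength_dyadic_cube flip: powr_real_of_int')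

lemma sidelength_eq_powr: "Q \<in> dyadic_cubes \<Longrightarrow> sidelength Q = 2 powr dyadic_level Q"
  by (auto simp: dyadic_cubes_def sidelength_dyadic_cube powr_real_of_int')

lemma dyadic_cubes_eqI:
  assumes "Q \<in> dyadic_cubes" "Q' \<in> dyadic_cubes" "x \<in> Q" "x \<in> Q'"
    and "dyadic_level Q = dyadic_level Q'"
  shows "Q = Q'"
proof -
  obtain k j k' j' where Q: "Q = dyadic_cube k j" "Q' = dyadic_cube k' j'"
    using assms by (auto simp: dyadic_cubes_def)
  \<comment> \<open>At level \<open>k\<close>, the index of the cube containing \<open>x\<close> is
    forced coordinatewise to be a floor, so equal levels force equal indices.\<close>
  have coord: "l i = \<lfloor>x $ i / 2 powi k\<rfloor>" if "x \<in> dyadic_cube k l" for l i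
    using that by (intro floor_unique[symmetric]) (auto simp: dyadic_cube_def field_simps)
  have "k = k'" using assms(5) by (simp add: Q)
  then have "j = j'"
    using coord[of j] coord[of j'] assms(3,4) by (auto simp: Q fun_eq_iff)
  then show ?thesis using \<open>k = k'\<close> by (simp add: Q)
qed

lemma dyadic_cube_borel: "Q \<in> dyadic_cubes \<Longrightarrow> Q \<in> sets borel"
  by (auto simp: dyadic_cubes_def dyadic_cube_def)

lemma bounded_dyadic_cube: "Q \<in> dyadic_cubes \<Longrightarrow> bounded Q"
proof -
  assume "Q \<in> dyadic_cubes"
  then obtain k j where "Q = dyadic_cube k j" by (auto simp: dyadic_cubes_def)
  then have "Q \<subseteq> cbox (\<chi> i. of_int (j i) * 2 powi k) (\<chi> i. (of_int (j i) + 1) * 2 powi k)"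
    by (auto simp: dyadic_cube_def mem_box_cart less_imp_le)
  then show ?thesis by (rule bounded_subset[OF bounded_cbox])
qed

lemma rect_set_borel: "R \<in> dyadic_rectangles \<Longrightarrow> rect_set R \<in> sets borel"
  by (auto simp: dyadic_rectangles_def rect_set_def intro!: borel_Times dyadic_cube_borel)

text \<open>Half-open rectangles are not compact, but they are bounded, and their closures have
  finite measure.\<close>

lemma emeasure_rect_set_finite:
  assumes "radon_measure \<mu>" "R \<in> dyadic_rectangles"
  shows "emeasure \<mu> (rect_set R) < \<infinity>"
proof -
  have "bounded (rect_set R)"
    using assms by (auto simp: dyadic_rectangles_def rect_set_def intro!: bounded_Times bounded_dyadic_cube)
  then have "compact (closure (rect_set R))" by simp
  then have "emeasure \<mu> (closure (rect_set R)) < \<infinity>" and "sets \<mu> = sets borel"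
    using assms unfolding radon_measure_def by blast+
  moreover have "emeasure \<mu> (rect_set R) \<le> emeasure \<mu> (closure (rect_set R))"
    using \<open>sets \<mu> = sets borel\<close> by (intro emeasure_mono closure_subset) simp
  ultimately show ?thesis by (rule_tac le_less_trans)
qed

text \<open>On dyadic rectangles, \<open>min_level\<close> and \<open>level_gap\<close> are the
  base-2 logarithms of the shorter side and of the ratio of the longer to the shorter side.\<close>

definition min_level :: "('n::finite, 'm::finite) rectangle \<Rightarrow> int" where
  "min_level R = min (dyadic_level (fst R)) (dyadic_level (snd R))"

definition level_gap :: "('n::finite, 'm::finite) rectangle \<Rightarrow> int" where
  "level_gap R = \<bar>dyadic_level (fst R) - dyadic_level (snd R)\<bar>"

text \<open>As \<alpha> = 1 - \<beta>, the product of powers is the shorter side times the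
  \<beta>-th power of the ratio of the sides.\<close>

lemma ell_eq_powr:
  assumes "R \<in> dyadic_rectangles" "\<alpha> + \<beta> = 1"
  shows "ell \<alpha> \<beta> R = 2 powr (real_of_int (min_level R) + \<beta> * level_gap R)"
proof -
  define k where "k = dyadic_level (fst R)"
  define l where "l = dyadic_level (snd R)"
  have s: "sidelength (fst R) = 2 powr k" "sidelength (snd R) = 2 powr l"
    using assms by (auto simp: dyadic_rectangles_def sidelength_eq_powr k_def l_def)
  have \<alpha>: "\<alpha> = 1 - \<beta>" using assms by simp
  show ?thesis
    unfolding \<alpha>
    by (cases "k \<le> l")
      (auto simp: ell_def ell_min_def ell_max_def min_level_def level_gap_def s powr_powr min_def max_def
        algebra_simps simp flip: powr_add k_def l_def)
qed

section \<open>Truncation at half the average\<close>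

text \<open>Where \<open>norm (f x) \<le> s / 2\<close>, the integral over \<open>A\<close> gains at
  most half of the lower bound \<open>s * measure M A\<close>; the other half must come from larger
  values.\<close>

lemma emeasure_le_of_large_average:
  fixes f :: "'a \<Rightarrow> complex"
  assumes f [measurable]: "f \<in> borel_measurable M" and A [measurable]: "A \<in> sets M"
    and fin: "emeasure M A < \<infinity>" and s: "0 < s"
    and large: "s * measure M A \<le> norm (LINT x:A|M. f x)"
  shows "emeasure M A \<le> ennreal (2 / s) *
    (\<integral>\<^sup>+x. ennreal (norm (f x) * indicator {x\<in>A. s / 2 < norm (f x)} x) \<partial>M)"
proof -
  let ?G = "\<integral>\<^sup>+x. ennreal (norm (f x) * indicator {x\<in>A. s / 2 < norm (f x)} x) \<partial>M"
  have mA: "emeasure M A = ennreal (measure M A)"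
    using fin by (intro emeasure_eq_ennreal_measure) auto
  have [measurable]: "{x\<in>A. s / 2 < norm (f x)} \<in> sets M"
  proof -
    have "{x\<in>A. s / 2 < norm (f x)} = A \<inter> {x\<in>space M. s / 2 < norm (f x)}"
      using sets.sets_into_space[OF A] by auto
    then show ?thesis by simp
  qed
  have "ennreal (s * measure M A) \<le> ennreal (norm (LINT x:A|M. f x))"
    using large by (rule ennreal_leI)
  also have "\<dots> \<le> (\<integral>\<^sup>+x. ennreal (norm (indicator A x *\<^sub>R f x)) \<partial>M)"
  proof (cases "integrable M (\<lambda>x. indicator A x *\<^sub>R f x)")
    case True
    then show ?thesis unfolding set_lebesgue_integral_def by (rule integral_norm_bound_ennreal)
  next
    \<comment> \<open>The integral of a non-integrable function is 0 by convention, so the bound is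
      trivial.\<close>
    case False
    then show ?thesis by (simp add: set_lebesgue_integral_def not_integrable_integral_eq)
  qed
  also have "\<dots> \<le> (\<integral>\<^sup>+x. ennreal (s / 2) * indicator A x
      + ennreal (norm (f x) * indicator {x\<in>A. s / 2 < norm (f x)} x) \<partial>M)"
    using s by (intro nn_integral_mono) (auto simp: indicator_def simp flip: ennreal_plus intro!: ennreal_leI)
  also have "\<dots> = ennreal (s / 2) * emeasure M A + ?G"
    by (subst nn_integral_add) (auto simp: nn_integral_cmult_indicator)
  also have "ennreal (s / 2) * emeasure M A = ennreal (s / 2 * measure M A)"
    unfolding mA using s by (intro ennreal_mult[symmetric]) auto
  finally have *: "ennreal (s * measure M A) \<le> ennreal (s / 2 * measure M A) + ?G" .
  show ?thesis
  \<comment> \<open>Absorbing \<open>s / 2 * measure M A\<close> into the left side is done in the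
    reals; for infinite \<open>?G\<close> the right side is infinite since
    \<open>2 / s > 0\<close>.\<close>
  proof (cases ?G)
    case (real g)
    then have "s * measure M A \<le> s / 2 * measure M A + g"
      using * s by (simp flip: ennreal_plus add: real(2))
    then have "measure M A \<le> 2 / s * g" using s by (simp add: field_simps)
    then show ?thesis using s real by (simp add: mA flip: ennreal_mult)
  next
    case top
    then show ?thesis using s by (simp add: ennreal_mult_top)
  qed
qed

section \<open>Powers of extended nonnegative reals\<close>

lemma ennreal_powr_mono: "0 \<le> r \<Longrightarrow> x \<le> y \<Longrightarrow> ennreal_powr x r \<le> ennreal_powr y r"
  by (auto simp: ennreal_powr_def top_unique intro!: ennreal_leI powr_mono2 enn2real_mono simp: less_top)

lemma ennreal_powr_cmult:
  assumes "0 < c"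
  shows "ennreal_powr (ennreal c * x) r = ennreal (c powr r) * ennreal_powr x r"
proof (cases x)
  case (real y)
  then show ?thesis using assms
    by (simp add: ennreal_powr_def powr_mult enn2real_mult flip: ennreal_mult)
next
  case top
  then show ?thesis using assms by (simp add: ennreal_powr_def ennreal_mult_top)
qed


section \<open>Rectangles through a point and large coefficients\<close>

text \<open>Rectangles through \<open>z\<close> are determined by their pair of levels, so the sum
  is one over pairs of integers.\<close>

lemma sum_rectangles_through_point_le:
  fixes c d e y :: real and F :: "('n::finite, 'm::finite) rectangle set"
  assumes "finite F" "F \<subseteq> dyadic_rectangles" "0 < c" "0 < d" "0 < e" "0 \<le> y"
    and z: "\<And>R. R \<in> F \<Longrightarrow> z \<in> rect_set R"
    and less: "\<And>R. R \<in> F \<Longrightarrow> 2 powr (- c * min_level R) < y"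
  shows "(\<Sum>R\<in>F. 2 powr (- d * min_level R) * 2 powr (- e * level_gap R))
    \<le> y powr (d / c) * (2 / ((1 - 2 powr (- d)) * (1 - 2 powr (- e))))"
proof -
  define h where "h = (\<lambda>R::('n, 'm) rectangle. (dyadic_level (fst R), dyadic_level (snd R)))"
  have inj: "inj_on h F"
  proof (rule inj_onI)
    fix R S assume RS: "R \<in> F" "S \<in> F" and eq: "h R = h S"
    have "R \<in> dyadic_rectangles" "S \<in> dyadic_rectangles" "z \<in> rect_set R" "z \<in> rect_set S"
      using RS assms(2) z by auto
    then have "fst R = fst S" "snd R = snd S"
      using eq dyadic_cubes_eqI[of "fst R" "fst S" "fst z"] dyadic_cubes_eqI[of "snd R" "snd S" "snd z"]
      by (auto simp: h_def dyadic_rectangles_def rect_set_def mem_Times_iff)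
    then show "R = S" by (simp add: prod_eq_iff)
  qed
  have "(\<Sum>R\<in>F. 2 powr (- d * min_level R) * 2 powr (- e * level_gap R)) =
      (\<Sum>(k, l)\<in>h ` F. 2 powr (- d * real_of_int (min k l)) * 2 powr (- e * \<bar>real_of_int (k - l)\<bar>))"
    using inj by (subst sum.reindex) (auto simp: h_def min_level_def level_gap_def intro!: sum.cong)
  also have "\<dots> \<le> y powr (d / c) * (2 / ((1 - 2 powr (- d)) * (1 - 2 powr (- e))))"
    using assms(1,3-6) less by (intro sum_powr_min_diff_le) (force simp: h_def min_level_def)+
  finally show ?thesis .
qed

text \<open>Since \<beta> \<le> 0 and the level gap is nonnegative,
  \<open>ell \<alpha> \<beta> R\<close> is at most the shorter side, which turns the threshold on
  the coefficient into one on the average.\<close>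

lemma norm_coeff_a_gt_imp_large_average:
  assumes "radon_measure \<mu>" "R \<in> dyadic_rectangles" "0 < p" "0 < \<gamma>" "\<alpha> + \<beta> = 1" "\<beta> \<le> 0"
    and "0 < t" and gt: "t < norm (coeff_a \<mu> p \<gamma> \<alpha> \<beta> f R)"
  shows "t * 2 powr (- (\<gamma> / p) * min_level R) * measure \<mu> (rect_set R)
    \<le> norm (LINT x:rect_set R|\<mu>. f x)"
proof -
  let ?m = "measure \<mu> (rect_set R)" and ?I = "norm (LINT x:rect_set R|\<mu>. f x)"
  \<comment> \<open>On null rectangles the coefficient is 0 by definition and cannot exceed
    \<open>t\<close>.\<close>
  have pos: "emeasure \<mu> (rect_set R) > 0"
    using gt \<open>0 < t\<close> by (auto simp: coeff_a_def split: if_splits)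
  then have m: "0 < ?m"
    using emeasure_rect_set_finite[OF assms(1,2)] by (simp add: measure_def enn2real_positive_iff)
  have "real_of_int (min_level R) + \<beta> * level_gap R \<le> min_level R"
    using \<open>\<beta> \<le> 0\<close> by (simp add: level_gap_def mult_nonpos_nonneg)
  then have "(\<gamma> / p) * (real_of_int (min_level R) + \<beta> * level_gap R) \<le> (\<gamma> / p) * min_level R"
    using assms by (intro mult_left_mono) auto
  then have L: "ell \<alpha> \<beta> R powr (\<gamma> / p) \<le> 2 powr ((\<gamma> / p) * min_level R)"
    using assms by (simp add: ell_eq_powr powr_powr mult.commute)
  have "t < ell \<alpha> \<beta> R powr (\<gamma> / p) * (1 / ?m) * ?I"
    using gt pos by (simp add: coeff_a_def norm_mult norm_divide norm_of_real)
  also have "\<dots> \<le> 2 powr ((\<gamma> / p) * min_level R) * (1 / ?m) * ?I"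
    using L m by (intro mult_right_mono) auto
  finally have "t * ?m < 2 powr ((\<gamma> / p) * min_level R) * ?I"
    using m by (simp add: field_simps)
  then show ?thesis
    by (simp add: powr_minus field_simps)
qed

section \<open>Weak-type bound for finite families\<close>

lemma sum_weighted_measure_le:
  fixes \<mu> :: "((real^'n::finite) \<times> (real^'m::finite)) measure"
    and p \<gamma> \<alpha> \<beta> \<alpha>' \<beta>' t :: real
  assumes radon: "radon_measure \<mu>" and p: "1 < p" and \<gamma>: "0 < \<gamma>"
    and \<beta>: "\<alpha> + \<beta> = 1" "\<beta> \<le> 0" and \<beta>': "\<alpha>' + \<beta>' = 1" "\<alpha>' < 1"
    and f [measurable]: "f \<in> borel_measurable \<mu>" and t: "0 < t"
    and F: "finite F" "F \<subseteq> {R \<in> dyadic_rectangles. norm (coeff_a \<mu> p \<gamma> \<alpha> \<beta> f R) > t}"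
  defines "K \<equiv> 2 / ((1 - 2 powr (- (\<gamma> / p * (p - 1)))) * (1 - 2 powr (- (\<gamma> * \<beta>'))))"
  shows "ennreal (t powr p) *
      (\<Sum>R\<in>F. ennreal (ell \<alpha>' \<beta>' R powr (- \<gamma>)) * emeasure \<mu> (rect_set R))
    \<le> ennreal (2 powr p * K) * (\<integral>\<^sup>+x. ennreal (norm (f x) powr p) \<partial>\<mu>)"
proof -
  \<comment> \<open>The exponents satisfy \<open>c + d = \<gamma>\<close> and
    \<open>d / c = p - 1\<close>; \<open>e\<close> is the decay rate in the level gap, positive
    because \<alpha>' < 1.\<close>
  define c where "c = \<gamma> / p"
  define d where "d = c * (p - 1)"
  define e where "e = \<gamma> * \<beta>'"
  have pos: "0 < c" "0 < d" "0 < e"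
    using p \<gamma> \<beta>' by (auto simp: c_def d_def e_def)
  have K: "0 < K"
    using pos by (auto simp: K_def powr_less_one simp flip: c_def d_def e_def intro!: divide_pos_pos mult_pos_pos)
  define s where "s R = t * 2 powr (- c * min_level R)" for R :: "('n, 'm) rectangle"
  define w where "w R = 2 powr (- d * min_level R) * 2 powr (- e * level_gap R)" for R :: "('n, 'm) rectangle"
  define E where "E R = {x \<in> rect_set R. s R / 2 < norm (f x)}" for R
  have s: "0 < s R" for R using t by (simp add: s_def)
  have w: "0 < w R" for R by (simp add: w_def)
  have sets: "sets \<mu> = sets borel" using radon by (simp add: radon_measure_def)
  have rect: "rect_set R \<in> sets \<mu>" if "R \<in> F" for R
    using that F by (auto simp: sets rect_set_borel)
  have E: "E R \<in> sets \<mu>" if "R \<in> F" for R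
  proof -
    have "E R = rect_set R \<inter> {x \<in> space \<mu>. s R / 2 < norm (f x)}"
      using sets.sets_into_space[OF rect[OF that]] by (auto simp: E_def)
    then show ?thesis using rect[OF that] by simp
  qed
  \<comment> \<open>The factor \<open>2 / s R\<close> contributes
    \<open>2 powr (c * min_level R)\<close>, which reduces the decay in the scale from \<gamma> to
    \<open>d = \<gamma> - c\<close>.\<close>
  have weight: "ell \<alpha>' \<beta>' R powr (- \<gamma>) * (2 / s R) = 2 / t * w R" if "R \<in> F" for R
  proof -
    have "R \<in> dyadic_rectangles" using that F by auto
    then have "ell \<alpha>' \<beta>' R powr (- \<gamma>) = 2 powr (- \<gamma> * min_level R) * 2 powr (- e * level_gap R)"
      using \<beta>' by (simp add: ell_eq_powr e_def powr_powr algebra_simps flip: powr_add)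
    moreover have "2 / s R = 2 / t * 2 powr (c * min_level R)"
      using t by (simp add: s_def powr_minus field_simps)
    moreover have "- \<gamma> = - d - c" using p by (simp add: c_def d_def field_simps)
    then have "2 powr (- d * min_level R) = 2 powr (- \<gamma> * min_level R) * 2 powr (c * min_level R)"
      by (simp only: powr_add[symmetric]) (simp add: algebra_simps)
    ultimately show ?thesis by (simp add: w_def)
  qed
  have single: "ennreal (ell \<alpha>' \<beta>' R powr (- \<gamma>)) * emeasure \<mu> (rect_set R)
      \<le> (\<integral>\<^sup>+x. ennreal (2 / t * w R * (norm (f x) * indicator (E R) x)) \<partial>\<mu>)" if R: "R \<in> F" for R
  proof -
    have D: "R \<in> dyadic_rectangles" "t < norm (coeff_a \<mu> p \<gamma> \<alpha> \<beta> f R)" using R F by auto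
    have "emeasure \<mu> (rect_set R) \<le> ennreal (2 / s R) *
        (\<integral>\<^sup>+x. ennreal (norm (f x) * indicator (E R) x) \<partial>\<mu>)"
      unfolding E_def
      using norm_coeff_a_gt_imp_large_average[OF radon D(1) _ \<gamma> \<beta> t D(2)] p
      by (intro emeasure_le_of_large_average f rect[OF R] emeasure_rect_set_finite[OF radon D(1)] s)
        (simp add: s_def c_def)
    then have "ennreal (ell \<alpha>' \<beta>' R powr (- \<gamma>)) * emeasure \<mu> (rect_set R) \<le>
        ennreal (ell \<alpha>' \<beta>' R powr (- \<gamma>)) * (ennreal (2 / s R) *
        (\<integral>\<^sup>+x. ennreal (norm (f x) * indicator (E R) x) \<partial>\<mu>))"
      by (rule mult_left_mono) simp
    also have "\<dots> = ennreal (ell \<alpha>' \<beta>' R powr (- \<gamma>) * (2 / s R)) *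
        (\<integral>\<^sup>+x. ennreal (norm (f x) * indicator (E R) x) \<partial>\<mu>)"
      using s[of R] by (subst ennreal_mult) (auto simp: mult.assoc less_imp_le)
    also have "\<dots> = (\<integral>\<^sup>+x. ennreal (2 / t * w R) * ennreal (norm (f x) * indicator (E R) x) \<partial>\<mu>)"
      unfolding weight[OF R] using E[OF R] by (intro nn_integral_cmult[symmetric]) simp
    also have "\<dots> = (\<integral>\<^sup>+x. ennreal (2 / t * w R * (norm (f x) * indicator (E R) x)) \<partial>\<mu>)"
      using t w[of R] by (intro nn_integral_cong ennreal_mult[symmetric]) auto
    finally show ?thesis .
  qed
  have point: "t powr p * (\<Sum>R\<in>F. 2 / t * w R * (norm (f x) * indicator (E R) x))
      \<le> 2 powr p * K * norm (f x) powr p" for x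
  proof (cases "f x = 0")
    case False
    define a where "a = norm (f x)"
    have a: "0 < a" using False by (simp add: a_def)
    have split: "(\<Sum>R\<in>F. 2 / t * w R * (a * indicator (E R) x)) = 2 / t * a * (\<Sum>R\<in>F. w R * indicator (E R) x)"
      by (simp add: sum_distrib_left mult_ac)
    have "(\<Sum>R\<in>F. w R * indicator (E R) x) = (\<Sum>R\<in>{R\<in>F. x \<in> E R}. w R)"
      using F(1) by (simp add: indicator_def if_distrib sum.If_cases Int_def cong: if_cong)
    \<comment> \<open>Membership of \<open>x\<close> in \<open>E R\<close> means
      \<open>s R / 2 < a\<close>, that is,
      \<open>2 powr (- c * min_level R) < 2 * a / t\<close>.\<close>
    also have "\<dots> \<le> (2 * a / t) powr (d / c) * K"
      unfolding w_def K_def c_def[symmetric] d_def[symmetric] e_def[symmetric]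
      using F pos a t
      by (intro sum_rectangles_through_point_le[where z = x]) (auto simp: E_def s_def a_def field_simps)
    also have "d / c = p - 1" using pos by (simp add: d_def)
    finally have "t powr p * (2 / t * a * (\<Sum>R\<in>F. w R * indicator (E R) x))
        \<le> t powr p * (2 / t * a * ((2 * a / t) powr (p - 1) * K))"
      using a t by (intro mult_left_mono) auto
    then have "t powr p * (\<Sum>R\<in>F. 2 / t * w R * (a * indicator (E R) x))
        \<le> t powr p * (2 / t * a * ((2 * a / t) powr (p - 1) * K))"
      by (simp only: split)
    \<comment> \<open>The factor \<open>2 / t * a\<close> raises the exponent from
      \<open>p - 1\<close> to \<open>p\<close>, after which \<open>t\<close> cancels.\<close>
    also have "\<dots> = t powr p * (2 * a / t) powr p * K"
      using a t by (simp add: powr_diff)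
    also have "\<dots> = 2 powr p * K * a powr p"
      using a t by (simp add: powr_divide powr_mult)
    finally show ?thesis by (simp add: a_def)
  qed simp
  \<comment> \<open>The single-rectangle bounds are added, the finite sum moves under the integral,
    and the pointwise bound is integrated.\<close>
  have "ennreal (t powr p) * (\<Sum>R\<in>F. ennreal (ell \<alpha>' \<beta>' R powr (- \<gamma>)) * emeasure \<mu> (rect_set R))
      \<le> ennreal (t powr p) *
        (\<Sum>R\<in>F. \<integral>\<^sup>+x. ennreal (2 / t * w R * (norm (f x) * indicator (E R) x)) \<partial>\<mu>)"
    by (intro mult_left_mono sum_mono single) auto
  also have "\<dots> = ennreal (t powr p) *
        (\<integral>\<^sup>+x. (\<Sum>R\<in>F. ennreal (2 / t * w R * (norm (f x) * indicator (E R) x))) \<partial>\<mu>)"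
    using E by (subst nn_integral_sum) auto
  also have "\<dots> = (\<integral>\<^sup>+x. ennreal (t powr p) *
        (\<Sum>R\<in>F. ennreal (2 / t * w R * (norm (f x) * indicator (E R) x))) \<partial>\<mu>)"
    using E by (intro nn_integral_cmult[symmetric]) auto
  also have "\<dots> = (\<integral>\<^sup>+x. ennreal (t powr p *
        (\<Sum>R\<in>F. 2 / t * w R * (norm (f x) * indicator (E R) x))) \<partial>\<mu>)"
    using t w by (intro nn_integral_cong) (simp add: sum_ennreal ennreal_mult sum_nonneg less_imp_le)
  also have "\<dots> \<le> (\<integral>\<^sup>+x. ennreal (2 powr p * K * norm (f x) powr p) \<partial>\<mu>)"
    by (intro nn_integral_mono ennreal_leI point)
  also have "\<dots> = (\<integral>\<^sup>+x. ennreal (2 powr p * K) * ennreal (norm (f x) powr p) \<partial>\<mu>)"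
    using K by (intro nn_integral_cong ennreal_mult) auto
  also have "\<dots> = ennreal (2 powr p * K) * (\<integral>\<^sup>+x. ennreal (norm (f x) powr p) \<partial>\<mu>)"
    by (intro nn_integral_cmult) simp
  finally show ?thesis .
qed

section \<open>Passage to all rectangles and all thresholds\<close>

theorem theorem4p1:
  fixes \<mu> :: "((real^'n::finite) \<times> (real^'m::finite)) measure"
    and p \<gamma> \<alpha> \<beta> \<alpha>' \<beta>' :: real
  assumes "radon_measure \<mu>"
    and "1 < p" and "0 < \<gamma>"
    and "\<alpha> + \<beta> = 1" and "\<beta> \<le> 0"
    and "\<alpha>' + \<beta>' = 1" and "0 \<le> \<alpha>'" and "\<alpha>' < 1"
  shows "\<exists>C::real. 0 < C \<and> (\<forall>f \<in> L1_loc \<mu>.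
      ennreal_powr
        (SUP t\<in>{0<..}. ennreal (t powr p) *
           (\<Sum>\<^sub>\<infinity>R\<in>{R \<in> dyadic_rectangles. norm (coeff_a \<mu> p \<gamma> \<alpha> \<beta> f R) > t}.
              ennreal (ell \<alpha>' \<beta>' R powr (-\<gamma>)) * emeasure \<mu> (rect_set R)))
        (1 / p)
      \<le> ennreal C * Lp_norm \<mu> p f)"
proof -
  define K where "K = 2 / ((1 - 2 powr (- (\<gamma> / p * (p - 1)))) * (1 - 2 powr (- (\<gamma> * \<beta>'))))"
  have "2 powr (- (\<gamma> / p * (p - 1))) < (1::real)" "2 powr (- (\<gamma> * \<beta>')) < (1::real)"
    using assms by (auto intro!: powr_less_one mult_pos_pos)
  then have K: "0 < 2 powr p * K" by (simp add: K_def)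
  show ?thesis
  \<comment> \<open>The constant is the \<open>p\<close>-th root of the one for finite families,
    which depends on neither \<open>f\<close> nor \<open>t\<close>.\<close>
  proof (intro exI[of _ "(2 powr p * K) powr (1 / p)"] conjI ballI)
    show "0 < (2 powr p * K) powr (1 / p)" using K by auto
  next
    fix f assume "f \<in> L1_loc \<mu>"
    then have f: "f \<in> borel_measurable \<mu>" by (simp add: L1_loc_def)
    let ?I = "\<integral>\<^sup>+x. ennreal (norm (f x) powr p) \<partial>\<mu>"
    let ?S = "SUP t\<in>{0<..}. ennreal (t powr p) *
           (\<Sum>\<^sub>\<infinity>R\<in>{R \<in> dyadic_rectangles. norm (coeff_a \<mu> p \<gamma> \<alpha> \<beta> f R) > t}.
              ennreal (ell \<alpha>' \<beta>' R powr (-\<gamma>)) * emeasure \<mu> (rect_set R))"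
    have "?S \<le> ennreal (2 powr p * K) * ?I"
    proof (rule SUP_least)
      fix t :: real assume "t \<in> {0<..}"
      \<comment> \<open>An infinite sum of extended nonnegative reals is the supremum of its finite
        partial sums, so a bound uniform over finite families suffices.\<close>
      then show "ennreal (t powr p) *
           (\<Sum>\<^sub>\<infinity>R\<in>{R \<in> dyadic_rectangles. norm (coeff_a \<mu> p \<gamma> \<alpha> \<beta> f R) > t}.
              ennreal (ell \<alpha>' \<beta>' R powr (-\<gamma>)) * emeasure \<mu> (rect_set R))
          \<le> ennreal (2 powr p * K) * ?I"
        using sum_weighted_measure_le[OF assms(1-6,8) f, of t] unfolding K_def
        by (auto simp: nonneg_infsum_complete SUP_mult_left_ennreal intro!: SUP_least)
    qed
    then have "ennreal_powr ?S (1 / p) \<le> ennreal_powr (ennreal (2 powr p * K) * ?I) (1 / p)"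
      using assms by (intro ennreal_powr_mono) auto
    also have "\<dots> = ennreal ((2 powr p * K) powr (1 / p)) * Lp_norm \<mu> p f"
      unfolding Lp_norm_def by (rule ennreal_powr_cmult[OF K])
    finally show "ennreal_powr ?S (1 / p) \<le> ennreal ((2 powr p * K) powr (1 / p)) * Lp_norm \<mu> p f" .
  qed
qed

end
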